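(* Let $A$ be a set of $n$ actions, let $f$ be a monotone Ultra reward function on $2^A$ and let $c:2^A\to\mathbb{R}_{\ge 0}$ be an additive cost function. Then the set $C_{f,c}$ of critical values satisfies $|C_{f,c}|\le \frac{n(n+1)}{2}$.
   Context: $A$ is a finite set of $n$ actions. A reward function $f:2^A\to\mathbb{R}_{\ge0}$ is monotone with $f(\emptyset)=0$; a cost function $c$ is additive if $c(S)=\sum_{a\in S}c(\{a\})$. For $\alpha\in[0,1]$ let $D_{f,c}(\alpha)=\operatorname{argmax}_{S\subseteq A}(\alpha f(S)-c(S))$ and $D^*_{f,c}(\alpha)=\operatorname{argmax}_{S\in D_{f,c}(\alpha)}f(S)$; elements of $D^*_{f,c}(\alpha)$ are the agent's best responses to $\alpha$. Critical values are the contracts at which the agent's best response changes: $C_{f,c}$ is the set of $\alpha\in(0,1]$ such that for some $\delta>0$, $D^*_{f,c}(\alpha')\ne D^*_{f,c}(\alpha)$ for all $\alpha'\in(\alpha-\delta,\alpha)\cap[0,1]$ (equivalently, the points of $(0,1]$ at which the step function $\alpha\mapsto f(S_\alpha)$, $S_\alpha\in D^*_{f,c}(\alpha)$, jumps). Ultra: $f$ is Ultra if it satisfies the exchange property: for all $S,T\subseteq A$ with $|S|\le|T|$ and every $x\in S\setminus T$ there is $y\in T\setminus S$ with $f(S)+f(T)\le f((S\setminus\{x\})\cup\{y\})+f((T\setminus\{y\})\cup\{x\})$. It is known that this is equivalent to the well-layered property: for every price vector $p\in\mathbb{R}^n_{\ge0}$ and every sequence $S_0=\emptyset$, $S_i=S_{i-1}\cup\{x_i\}$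 with $x_i\in\operatorname{argmax}_{x\notin S_{i-1}}\{f(S_{i-1}\cup\{x\})-f(S_{i-1})-p_x\}$ (ties broken arbitrarily), one has $S_i\in\operatorname{argmax}_{|S|=i}\{f(S)-\sum_{x\in S}p_x\}$ for every $i\in[n]$. *)

theory Defs
  imports Complex_Main
begin

definition additive_on :: "'a set \<Rightarrow> ('a set \<Rightarrow> real) \<Rightarrow> bool" where
  "additive_on A c \<longleftrightarrow> (\<forall>S\<subseteq>A. c S = (\<Sum>a\<in>S. c {a}))"

definition demand :: "'a set \<Rightarrow> ('a set \<Rightarrow> real) \<Rightarrow> ('a set \<Rightarrow> real) \<Rightarrow> real \<Rightarrow> 'a set set" where
  "demand A f c \<alpha> = {S. is_arg_max (\<lambda>S. \<alpha> * f S - c S) (\<lambda>S. S \<subseteq> A) S}"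

text \<open>Ties in the agent's utility are broken in favour of the larger reward.\<close>

definition best_responses :: "'a set \<Rightarrow> ('a set \<Rightarrow> real) \<Rightarrow> ('a set \<Rightarrow> real) \<Rightarrow> real \<Rightarrow> 'a set set" where
  "best_responses A f c \<alpha> = {S. is_arg_max f (\<lambda>S. S \<in> demand A f c \<alpha>) S}"

definition critical_values :: "'a set \<Rightarrow> ('a set \<Rightarrow> real) \<Rightarrow> ('a set \<Rightarrow> real) \<Rightarrow> real set" where
  "critical_values A f c =
     {\<alpha>. 0 < \<alpha> \<and> \<alpha> \<le> 1 \<and>
       (\<exists>\<delta>>0. \<forall>\<alpha>' \<in> {\<alpha> - \<delta><..<\<alpha>} \<inter> {0..1}. best_responses A f c \<alpha>' \<noteq> best_responses A f c \<alpha>)}"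

definition ultra :: "'a set \<Rightarrow> ('a set \<Rightarrow> real) \<Rightarrow> bool" where
  "ultra A f \<longleftrightarrow>
     (\<forall>S T. S \<subseteq> A \<longrightarrow> T \<subseteq> A \<longrightarrow> card S \<le> card T \<longrightarrow>
       (\<forall>x \<in> S - T. \<exists>y \<in> T - S.
          f S + f T \<le> f ((S - {x}) \<union> {y}) + f ((T - {y}) \<union> {x})))"

end

theory Submission
  imports Defs
begin

text \<open>
  Rank the actions by cost, actions of equal cost sharing a rank and actions of cost zero having
  rank zero, and let the potential of a set be the sum of the ranks of its members; it is at most
  \<open>n(n+1)/2\<close>. At a contract where several rewards are optimal, take a demanded set \<open>S\<close> of least
  reward and one \<open>T\<close> of greatest reward. Exchanging elements of the larger of the two for elements
  of the smaller stays within the demand, because both new sets are at least as good in total.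
  Hence the extremality of \<open>S\<close> and \<open>T\<close> forces every exchange to go from cheap to expensive. If \<open>S\<close>
  is the larger set, the surplus elements end up next to the most expensive set \<open>T\<close>, so they cost
  nothing and have rank zero. In both cases the potential of \<open>T\<close> strictly exceeds that of \<open>S\<close>. As the contract grows, the potential of the best
  response therefore strictly increases at each critical value.
\<close>

section \<open>Ranks of actions by cost\<close>

text \<open>\<open>Suc\<close> keeps the rank of every action of nonzero cost above zero, even that
  of the cheapest one, so rank and cost vanish together.\<close>

definition cost_rank :: "'a set \<Rightarrow> ('a \<Rightarrow> real) \<Rightarrow> 'a \<Rightarrow> nat" where
  "cost_rank A w a = (if w a = 0 then 0 else Suc (card {b \<in> A. w b < w a}))"

lemma cost_rank_strict_mono:
  assumes "finite A" "a \<in> A" "0 \<le> w a" "w a < w b"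
  shows "cost_rank A w a < cost_rank A w b"
proof -
  have "card {x \<in> A. w x < w a} < card {x \<in> A. w x < w b}"
    using assms by (intro psubset_card_mono) auto
  then show ?thesis
    using assms by (auto simp: cost_rank_def)
qed

lemma cost_rank_mono:
  assumes "finite A" "a \<in> A" "0 \<le> w a" "w a \<le> w b"
  shows "cost_rank A w a \<le> cost_rank A w b"
proof (cases "w a = w b")
  case True
  then show ?thesis by (simp add: cost_rank_def)
next
  case False
  then show ?thesis
    using cost_rank_strict_mono[of A a w b] assms by simp
qed

text \<open>Adding an element \<open>m\<close> of largest weight leaves the counts of the others
  unchanged, since \<open>m\<close> lies strictly below none of them, and its own count is at most
  the old cardinality.\<close>

lemma sum_Suc_card_less_le:
  fixes w :: "'a \<Rightarrow> 'b::linorder"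
  assumes "finite A"
  shows "(\<Sum>a\<in>A. Suc (card {b \<in> A. w b < w a})) \<le> card A * (card A + 1) div 2"
  using assms
proof (induction A rule: finite_ranking_induct[where f = w])
  case empty
  then show ?case by simp
next
  case (insert m A)
  show ?case
  \<comment> \<open>The ranking induction allows \<open>m\<close> to be present already.\<close>
  proof (cases "m \<in> A")
    case True
    then show ?thesis
      using insert.IH by (simp add: insert_absorb)
  next
    case False
    have "card {b \<in> insert m A. w b < w m} \<le> card A"
      using insert by (intro card_mono) auto
    moreover have "{b \<in> insert m A. w b < w a} = {b \<in> A. w b < w a}" if "a \<in> A" for a
      using insert that by force
    then have "(\<Sum>a\<in>A. Suc (card {b \<in> insert m A. w b < w a}))
        = (\<Sum>a\<in>A. Suc (card {b \<in> A. w b < w a}))"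
      by (intro sum.cong) auto
    moreover have "(\<Sum>a\<in>insert m A. Suc (card {b \<in> insert m A. w b < w a}))
        = Suc (card {b \<in> insert m A. w b < w m})
          + (\<Sum>a\<in>A. Suc (card {b \<in> insert m A. w b < w a}))"
      using insert.hyps(1) False by (rule sum.insert)
    ultimately have "(\<Sum>a\<in>insert m A. Suc (card {b \<in> insert m A. w b < w a}))
        \<le> Suc (card A) + (\<Sum>a\<in>A. Suc (card {b \<in> A. w b < w a}))"
      by linarith
    also have "\<dots> \<le> Suc (card A) + card A * (card A + 1) div 2"
      using insert.IH by simp
    also have "\<dots> = card (insert m A) * (card (insert m A) + 1) div 2"
      using insert.hyps(1) False by simp
    finally show ?thesis .
  qed
qed

lemma sum_cost_rank_le:
  assumes "finite A" "T \<subseteq> A"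
  shows "(\<Sum>a\<in>T. cost_rank A w a) \<le> card A * (card A + 1) div 2"
proof -
  have "(\<Sum>a\<in>T. cost_rank A w a) \<le> (\<Sum>a\<in>A. cost_rank A w a)"
    using assms by (intro sum_mono2) auto
  also have "\<dots> \<le> (\<Sum>a\<in>A. Suc (card {b \<in> A. w b < w a}))"
    by (intro sum_mono) (simp add: cost_rank_def)
  also have "\<dots> \<le> card A * (card A + 1) div 2"
    using assms by (intro sum_Suc_card_less_le)
  finally show ?thesis .
qed

text \<open>Equal weights along all of \<open>g\<close> would make the two totals equal, so some
  pair is strict in weight and hence in rank.\<close>

lemma sum_cost_rank_bij_less:
  assumes "finite A" "S \<subseteq> A" "T \<subseteq> A" "\<And>a. a \<in> A \<Longrightarrow> 0 \<le> w a"
    and g: "bij_betw g S T" "\<And>a. a \<in> S \<Longrightarrow> w a \<le> w (g a)"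
    and less: "(\<Sum>a\<in>S. w a) < (\<Sum>a\<in>T. w a)"
  shows "(\<Sum>a\<in>S. cost_rank A w a) < (\<Sum>a\<in>T. cost_rank A w a)"
proof -
  have "finite S"
    using assms finite_subset by blast
  have "\<exists>a\<in>S. w a < w (g a)"
  proof (rule ccontr)
    assume "\<not> (\<exists>a\<in>S. w a < w (g a))"
    then have "(\<Sum>a\<in>S. w (g a)) \<le> (\<Sum>a\<in>S. w a)"
      by (intro sum_mono) force
    then show False
      using less sum.reindex_bij_betw[OF g(1), of w] by simp
  qed
  moreover have "cost_rank A w a < cost_rank A w (g a)" if "a \<in> S" "w a < w (g a)" for a
    using that assms by (intro cost_rank_strict_mono) auto
  ultimately have "\<exists>a\<in>S. cost_rank A w a < cost_rank A w (g a)"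
    by blast
  moreover have "\<forall>a\<in>S. cost_rank A w a \<le> cost_rank A w (g a)"
    using assms by (auto intro!: cost_rank_mono)
  ultimately have "(\<Sum>a\<in>S. cost_rank A w a) < (\<Sum>a\<in>S. cost_rank A w (g a))"
    using \<open>finite S\<close> by (intro sum_strict_mono_ex1) auto
  then show ?thesis
    using sum.reindex_bij_betw[OF g(1), of "cost_rank A w"] by simp
qed

lemma ex_is_arg_max_finite:
  fixes u :: "'a \<Rightarrow> real"
  assumes "finite D" "D \<noteq> {}"
  shows "\<exists>x. is_arg_max u (\<lambda>x. x \<in> D) x"
proof -
  have "is_arg_min (\<lambda>x. - u x) P x \<Longrightarrow> is_arg_max u P x" for P x
    by (auto simp: is_arg_min_def is_arg_max_def)
  then show ?thesis
    using ex_is_arg_min_if_finite[OF assms, of "\<lambda>x. - u x"] by blast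
qed

section \<open>Repeated exchange towards a superset\<close>

text \<open>\<open>P\<close> stays fixed while \<open>Q\<close> trades some \<open>y\<close> outside
  \<open>P\<close> for a missing \<open>x\<close> of \<open>P\<close>, until it contains
  \<open>P\<close>. The other half of each exchange, \<open>P\<close> with \<open>x\<close> replaced
  by \<open>y\<close>, lies in \<open>D\<close>, so extremality orders the weights of
  \<open>x\<close> and \<open>y\<close>. The bijection \<open>g\<close> undoes the trades.\<close>

lemma exchange_to_superset:
  fixes w :: "'a \<Rightarrow> real"
  assumes fin: "\<And>U. U \<in> D \<Longrightarrow> finite U" and P: "P \<in> D"
    and exch: "\<And>Q x. \<lbrakk>Q \<in> D; card P \<le> card Q; x \<in> P - Q\<rbrakk> \<Longrightarrow>
      \<exists>y\<in>Q - P. insert y (P - {x}) \<in> D \<and> insert x (Q - {y}) \<in> D"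
    and extremal: "\<And>x y. \<lbrakk>x \<in> P; y \<notin> P; insert y (P - {x}) \<in> D\<rbrakk> \<Longrightarrow> w x \<le> w y"
    and Q: "Q \<in> D" "card P \<le> card Q"
  shows "\<exists>R\<in>D. P \<subseteq> R \<and> (\<exists>g. bij_betw g R Q \<and> (\<forall>a\<in>R. w a \<le> w (g a)))"
  using Q
proof (induction "card (P - Q)" arbitrary: Q)
  case 0
  then have "P \<subseteq> Q"
    using fin[OF P] by simp
  then show ?case
    using 0 by (intro bexI[of _ Q] conjI exI[of _ id]) (simp_all add: bij_betw_def)
next
  case (Suc k)
  then obtain x where x: "x \<in> P - Q"
    by (metis card.empty equals0I nat.distinct(1))
  obtain y where y: "y \<in> Q - P" "insert y (P - {x}) \<in> D" "insert x (Q - {y}) \<in> D"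
    using exch[OF Suc.prems x] by blast
  let ?Q = "insert x (Q - {y})"
  have "finite Q"
    using fin Suc.prems by blast
  then have "card ?Q = card Q"
    using x y by (metis DiffD1 DiffD2 Suc_pred' card_gt_0_iff card_Diff_singleton card_insert_disjoint
        empty_iff finite_Diff)
  moreover have "P - ?Q = (P - Q) - {x}"
    using y by auto
  then have "k = card (P - ?Q)"
    using Suc.hyps(2) x by simp
  ultimately obtain R g where R: "R \<in> D" "P \<subseteq> R" "bij_betw g R ?Q" "\<forall>a\<in>R. w a \<le> w (g a)"
    using Suc.hyps(1)[of ?Q] y Suc.prems by auto
  let ?h = "id(x := y)"
  have "bij_betw ?h ?Q Q"
    using x y unfolding bij_betw_def inj_on_def by (auto simp: image_iff)
  then have "bij_betw (?h \<circ> g) R Q"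
    using R(3) bij_betw_trans by blast
  moreover have "w x \<le> w y"
    using extremal x y by auto
  then have "\<forall>a\<in>R. w a \<le> w ((?h \<circ> g) a)"
    using R(4) by force
  ultimately show ?case
    using R by blast
qed

section \<open>Demand and best responses as the contract varies\<close>

locale ultra_contract =
  fixes A :: "'a set" and f c :: "'a set \<Rightarrow> real"
  assumes finite_actions: "finite A"
    and ultra_reward: "ultra A f"
    and cost_nonneg: "\<And>S. S \<subseteq> A \<Longrightarrow> c S \<ge> 0"
    and additive_cost: "additive_on A c"
begin

abbreviation best :: "real \<Rightarrow> 'a set set" where
  "best \<equiv> best_responses A f c"

definition potential :: "'a set \<Rightarrow> nat" where
  "potential S = (\<Sum>a\<in>S. cost_rank A (\<lambda>a. c {a}) a)"

lemma cost_sum: "S \<subseteq> A \<Longrightarrow> c S = (\<Sum>a\<in>S. c {a})"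
  using additive_cost by (simp add: additive_on_def)

lemma finite_action_set: "S \<subseteq> A \<Longrightarrow> finite S"
  using finite_actions finite_subset by blast

lemma cost_exchange:
  assumes "S \<subseteq> A" "x \<in> S" "y \<in> A - S"
  shows "c (insert y (S - {x})) = c S - c {x} + c {y}"
proof -
  have "c (insert y (S - {x})) = (\<Sum>a\<in>insert y (S - {x}). c {a})"
    using assms by (intro cost_sum) auto
  also have "\<dots> = c {y} + (\<Sum>a\<in>S - {x}. c {a})"
    using assms finite_action_set[OF assms(1)] by simp
  also have "(\<Sum>a\<in>S - {x}. c {a}) = (\<Sum>a\<in>S. c {a}) - c {x}"
    using assms finite_action_set[OF assms(1)] by (simp add: sum_diff1)
  finally show ?thesis
    using cost_sum[OF assms(1)] by simp
qed

lemma demand_iff: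
  "S \<in> demand A f c \<alpha> \<longleftrightarrow> S \<subseteq> A \<and> (\<forall>U\<subseteq>A. \<alpha> * f U - c U \<le> \<alpha> * f S - c S)"
  by (auto simp: demand_def is_arg_max_linorder)

lemma demand_le:
  "\<lbrakk>S \<in> demand A f c \<alpha>; U \<subseteq> A\<rbrakk> \<Longrightarrow> \<alpha> * f U - c U \<le> \<alpha> * f S - c S"
  by (simp add: demand_iff)

lemma demand_if_demand_le:
  assumes "S \<in> demand A f c \<alpha>" "U \<subseteq> A" "\<alpha> * f S - c S \<le> \<alpha> * f U - c U"
  shows "U \<in> demand A f c \<alpha>"
  using assms order_trans unfolding demand_iff by blast

lemma demand_subset: "S \<in> demand A f c \<alpha> \<Longrightarrow> S \<subseteq> A"
  by (simp add: demand_iff)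

lemma best_iff:
  "S \<in> best \<alpha> \<longleftrightarrow> S \<in> demand A f c \<alpha> \<and> (\<forall>U\<in>demand A f c \<alpha>. f U \<le> f S)"
  by (auto simp: best_responses_def is_arg_max_linorder)

lemma best_demand: "S \<in> best \<alpha> \<Longrightarrow> S \<in> demand A f c \<alpha>"
  by (simp add: best_iff)

lemma best_subset: "S \<in> best \<alpha> \<Longrightarrow> S \<subseteq> A"
  using best_demand demand_subset by blast

lemma best_nonempty: "best \<alpha> \<noteq> {}"
proof -
  let ?u = "\<lambda>S. \<alpha> * f S - c S"
  obtain S where "is_arg_max ?u (\<lambda>S. S \<in> Pow A) S"
    using ex_is_arg_max_finite[of "Pow A" ?u] finite_actions by auto
  then have "demand A f c \<alpha> \<noteq> {}"
    by (auto simp: demand_def)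
  moreover have "finite (demand A f c \<alpha>)"
    by (rule finite_subset[of _ "Pow A"]) (simp_all add: finite_actions demand_subset subsetI)
  ultimately show ?thesis
    using ex_is_arg_max_finite[of "demand A f c \<alpha>" f] unfolding best_responses_def by blast
qed

text \<open>Adding the two optimality inequalities cancels the costs.\<close>

lemma demand_reward_mono:
  assumes "S \<in> demand A f c \<alpha>" "T \<in> demand A f c \<beta>" "\<alpha> < \<beta>"
  shows "f S \<le> f T"
proof -
  have "\<alpha> * f T - c T \<le> \<alpha> * f S - c S" "\<beta> * f S - c S \<le> \<beta> * f T - c T"
    using assms demand_le demand_subset by blast+
  then have "0 \<le> (\<beta> - \<alpha>) * (f T - f S)"
    by (simp add: algebra_simps)
  then show ?thesis
    using assms(3) by (simp add: zero_le_mult_iff)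
qed

lemma best_reward_mono:
  assumes "S \<in> best \<alpha>" "T \<in> best \<beta>" "\<alpha> \<le> \<beta>"
  shows "f S \<le> f T"
  using assms demand_reward_mono by (cases "\<alpha> = \<beta>") (auto simp: best_iff)

text \<open>Among sets of equal reward, utilities compare as costs do, and this comparison does not
  depend on the contract.\<close>

lemma best_subset_if_reward_eq:
  assumes "S \<in> best \<alpha>" "T \<in> best \<beta>" "f S = f T"
  shows "best \<beta> \<subseteq> best \<alpha>"
proof
  fix U assume U: "U \<in> best \<beta>"
  then have eq: "f U = f S"
    using assms by (simp add: best_iff order_antisym)
  have "\<beta> * f S - c S \<le> \<beta> * f U - c U"
    using demand_le best_demand[OF U] best_subset[OF assms(1)] by blast
  then have "U \<in> demand A f c \<alpha>"
    using demand_if_demand_le[OF best_demand[OF assms(1)] best_subset[OF U]] eq by simp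
  then show "U \<in> best \<alpha>"
    using assms(1) eq by (simp add: best_iff)
qed

lemma best_eq_if_reward_eq:
  assumes "S \<in> best \<alpha>" "T \<in> best \<beta>" "f S = f T"
  shows "best \<alpha> = best \<beta>"
  using best_subset_if_reward_eq assms by (metis subset_antisym)

lemma critical_reward_less:
  assumes "\<beta> \<in> critical_values A f c" "0 \<le> \<alpha>" "\<alpha> < \<beta>" "S \<in> best \<alpha>" "T \<in> best \<beta>"
  shows "f S < f T"
proof (rule ccontr)
  assume "\<not> f S < f T"
  then have eq: "f S = f T"
    using best_reward_mono assms by force
  obtain \<delta> where \<delta>: "\<delta> > 0" "\<And>\<gamma>. \<gamma> \<in> {\<beta> - \<delta><..<\<beta>} \<inter> {0..1} \<Longrightarrow> best \<gamma> \<noteq> best \<beta>"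
    and "\<beta> \<le> 1"
    using assms(1) by (auto simp: critical_values_def)
  \<comment> \<open>Between \<open>\<alpha>\<close> and \<open>\<beta>\<close> monotonicity pins the
    reward to the common value, so any contract there that also lies in the \<open>\<delta>\<close>
    window gives a contradiction.\<close>
  obtain \<gamma> where \<gamma>: "max \<alpha> (\<beta> - \<delta>) < \<gamma>" "\<gamma> < \<beta>"
    using dense[of "max \<alpha> (\<beta> - \<delta>)" \<beta>] assms(3) \<delta>(1) by auto
  obtain U where U: "U \<in> best \<gamma>"
    using best_nonempty by blast
  have "f S \<le> f U" "f U \<le> f T"
    using best_reward_mono U assms \<gamma> by (meson less_imp_le max_less_iff_conj)+
  then have "best \<gamma> = best \<beta>"
    using best_eq_if_reward_eq U assms(5) eq by simp
  then show False
    using \<delta>(2) \<gamma> assms(2) \<open>\<beta> \<le> 1\<close> by simp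
qed

text \<open>The exchange keeps the total cost and does not lower the total reward. The two new
  utilities thus add up to at least twice the maximum, so both attain it.\<close>

lemma demand_exchange:
  assumes "P \<in> demand A f c \<alpha>" "Q \<in> demand A f c \<alpha>" "0 \<le> \<alpha>" "card P \<le> card Q" "x \<in> P - Q"
  shows "\<exists>y\<in>Q - P. insert y (P - {x}) \<in> demand A f c \<alpha> \<and> insert x (Q - {y}) \<in> demand A f c \<alpha>"
proof -
  have sub: "P \<subseteq> A" "Q \<subseteq> A"
    using assms demand_subset by blast+
  have "\<exists>y\<in>Q - P. f P + f Q \<le> f ((P - {x}) \<union> {y}) + f ((Q - {y}) \<union> {x})"
    using ultra_reward sub assms(4,5) unfolding ultra_def by blast
  then obtain y where y: "y \<in> Q - P"
    and ex: "f P + f Q \<le> f (insert y (P - {x})) + f (insert x (Q - {y}))"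
    by auto
  let ?P = "insert y (P - {x})" and ?Q = "insert x (Q - {y})"
  have in_A: "x \<in> A" "y \<in> A"
    using sub y assms(5) by blast+
  then have sub': "?P \<subseteq> A" "?Q \<subseteq> A"
    using sub by blast+
  have "c ?P + c ?Q = c P + c Q"
    using cost_exchange[of P x y] cost_exchange[of Q y x] sub in_A y assms(5) by simp
  moreover have "\<alpha> * (f P + f Q) \<le> \<alpha> * (f ?P + f ?Q)"
    using ex assms(3) by (rule mult_left_mono)
  ultimately have sum: "(\<alpha> * f P - c P) + (\<alpha> * f Q - c Q) \<le> (\<alpha> * f ?P - c ?P) + (\<alpha> * f ?Q - c ?Q)"
    by (simp add: algebra_simps)
  have le: "\<alpha> * f U - c U \<le> \<alpha> * f P - c P" "\<alpha> * f U - c U \<le> \<alpha> * f Q - c Q" if "U \<subseteq> A" for U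
    using that assms demand_le by auto
  have "?P \<in> demand A f c \<alpha>"
    unfolding demand_iff using sub' le sum by (smt (verit))
  moreover have "?Q \<in> demand A f c \<alpha>"
    unfolding demand_iff using sub' le sum by (smt (verit))
  ultimately show ?thesis
    using y by blast
qed

section \<open>Potential compared with cost\<close>

lemma potential_bij_less:
  assumes "S \<subseteq> A" "T \<subseteq> A" "bij_betw g S T" "\<And>a. a \<in> S \<Longrightarrow> c {a} \<le> c {g a}" "c S < c T"
  shows "potential S < potential T"
  unfolding potential_def
  using assms finite_actions cost_nonneg cost_sum[of S] cost_sum[of T]
  by (intro sum_cost_rank_bij_less[where g = g]) auto

lemma potential_mono: "\<lbrakk>S \<subseteq> T; T \<subseteq> A\<rbrakk> \<Longrightarrow> potential S \<le> potential T"
  unfolding potential_def using finite_action_set by (intro sum_mono2) auto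

text \<open>The cost gap and the potential gap of nested sets are sums of nonnegative terms over
  \<open>T - S\<close>, and these terms vanish at the same actions.\<close>

lemma
  assumes "S \<subseteq> T" "T \<subseteq> A"
  shows cost_mono: "c S \<le> c T"
    and potential_less_if_cost_less: "c S < c T \<Longrightarrow> potential S < potential T"
    and potential_eq_if_cost_eq: "c S = c T \<Longrightarrow> potential S = potential T"
proof -
  have fin: "finite T"
    using assms finite_action_set by blast
  have nonneg: "0 \<le> c {a}" if "a \<in> T - S" for a
    using that assms cost_nonneg by auto
  have diff: "(\<Sum>a\<in>T - S. c {a}) = c T - c S"
    using assms fin cost_sum[of S] cost_sum[of T] by (simp add: sum_diff)
  have pot: "potential T = potential S + (\<Sum>a\<in>T - S. cost_rank A (\<lambda>a. c {a}) a)"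
    unfolding potential_def using sum.subset_diff[OF assms(1) fin, of "cost_rank A (\<lambda>a. c {a})"]
    by simp
  have rank0: "cost_rank A (\<lambda>a. c {a}) a = 0 \<longleftrightarrow> c {a} = 0" for a
    by (simp add: cost_rank_def)
  have "0 \<le> c T - c S"
    unfolding diff[symmetric] using nonneg by (rule sum_nonneg)
  then show "c S \<le> c T" by simp
  have iff: "c T - c S = 0 \<longleftrightarrow> (\<forall>a\<in>T - S. c {a} = 0)"
    unfolding diff[symmetric] using nonneg fin by (intro sum_nonneg_eq_0_iff) auto
  show "potential S = potential T" if "c S = c T"
  proof -
    have "(\<Sum>a\<in>T - S. cost_rank A (\<lambda>a. c {a}) a) = 0"
      using that iff rank0 by (intro sum.neutral) auto
    then show ?thesis
      using pot by simp
  qed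
  show "potential S < potential T" if "c S < c T"
  proof -
    have "c T - c S \<noteq> 0"
      using that by simp
    then obtain a where "a \<in> T - S" "c {a} \<noteq> 0"
      using iff by blast
    then have "(\<Sum>a\<in>T - S. cost_rank A (\<lambda>a. c {a}) a) \<noteq> 0"
      using fin rank0 by auto
    then show ?thesis
      using pot by simp
  qed
qed

text \<open>All demanded sets have the same utility, so cost increases with reward among them. Hence
  \<open>S\<close> is cheapest and \<open>T\<close> most expensive, which is the extremality that
  \<open>exchange_to_superset\<close> asks for.\<close>

lemma potential_less_in_demand:
  assumes S: "S \<in> demand A f c \<alpha>" "\<And>U. U \<in> demand A f c \<alpha> \<Longrightarrow> f S \<le> f U"
    and T: "T \<in> best \<alpha>"
    and "0 < \<alpha>" "f S < f T"
  shows "potential S < potential T"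
proof -
  let ?D = "demand A f c \<alpha>"
  note TD = best_demand[OF T] and sub = demand_subset[OF S(1)] best_subset[OF T]
  have cost: "c U - c V = \<alpha> * (f U - f V)" if "U \<in> ?D" "V \<in> ?D" for U V
    using demand_le[OF that(1), of V] demand_le[OF that(2), of U] demand_subset that
    by (simp add: algebra_simps)
  have S_min: "c S \<le> c U" and T_max: "c U \<le> c T" if "U \<in> ?D" for U
  proof -
    have "0 \<le> \<alpha> * (f U - f S)" "0 \<le> \<alpha> * (f T - f U)"
      using that S(2) T \<open>0 < \<alpha>\<close> by (auto simp: best_iff)
    then show "c S \<le> c U" "c U \<le> c T"
      using cost[of U S] cost[of T U] that S TD by auto
  qed
  have "0 < \<alpha> * (f T - f S)"
    using assms by simp
  then have less: "c S < c T"
    using cost[OF TD S(1)] by simp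
  show ?thesis
  proof (cases "card S \<le> card T")
    case True
    have "c {x} \<le> c {y}" if "x \<in> S" "y \<notin> S" "insert y (S - {x}) \<in> ?D" for x y
      using S_min[OF that(3)] cost_exchange[of S x y] sub that demand_subset[OF that(3)] by auto
    then have "\<exists>R\<in>?D. S \<subseteq> R \<and> (\<exists>g. bij_betw g R T \<and> (\<forall>a\<in>R. c {a} \<le> c {g a}))"
      using S(1) TD True \<open>0 < \<alpha>\<close>
      by (intro exchange_to_superset demand_exchange finite_action_set demand_subset) auto
    then obtain R g where R: "R \<in> ?D" "S \<subseteq> R" "bij_betw g R T" "\<forall>a\<in>R. c {a} \<le> c {g a}"
      by blast
    have RA: "R \<subseteq> A"
      using R demand_subset by blast
    show ?thesis
    \<comment> \<open>\<open>g\<close> only gives weak inequalities. Strictness arises between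
      \<open>R\<close> and \<open>T\<close> if \<open>R\<close> is cheaper, and otherwise between
      \<open>S\<close> and \<open>R\<close>, as then \<open>c S < c T \<le> c R\<close>.\<close>
    proof (cases "c R < c T")
      case True
      then have "potential R < potential T"
        using potential_bij_less R RA sub by blast
      then show ?thesis
        using potential_mono[OF R(2) RA] by simp
    next
      case False
      have "potential R \<le> potential T"
        unfolding potential_def sum.reindex_bij_betw[OF R(3), symmetric]
        using R RA finite_actions cost_nonneg by (intro sum_mono cost_rank_mono) auto
      moreover have "potential S < potential R"
        using False less R RA by (intro potential_less_if_cost_less) auto
      ultimately show ?thesis by simp
    qed
  next
    case False
    \<comment> \<open>Now \<open>T\<close> is the smaller set and takes the role of
      \<open>P\<close>; negated costs turn its maximality into the required form.\<close>
    have "- c {x} \<le> - c {y}" if "x \<in> T" "y \<notin> T" "insert y (T - {x}) \<in> ?D" for x y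
      using T_max[OF that(3)] cost_exchange[of T x y] sub that demand_subset[OF that(3)] by auto
    then have "\<exists>R\<in>?D. T \<subseteq> R \<and> (\<exists>g. bij_betw g R S \<and> (\<forall>a\<in>R. - c {a} \<le> - c {g a}))"
      using S(1) TD False \<open>0 < \<alpha>\<close>
      by (intro exchange_to_superset demand_exchange finite_action_set demand_subset) auto
    then obtain R g where R: "R \<in> ?D" "T \<subseteq> R" "bij_betw g R S" "\<forall>a\<in>R. - c {a} \<le> - c {g a}"
      by blast
    have RA: "R \<subseteq> A"
      using R demand_subset by blast
    \<comment> \<open>No demanded set costs more than \<open>T\<close>, so the elements of
      \<open>R\<close> outside \<open>T\<close> are free.\<close>
    have "c T = c R"
      using cost_mono[OF R(2) RA] T_max[OF R(1)] by simp
    then have "potential T = potential R"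
      using potential_eq_if_cost_eq[OF R(2) RA] by simp
    moreover have "potential S < potential R"
    proof (rule potential_bij_less)
      show "bij_betw (inv_into R g) S R"
        using R(3) by (rule bij_betw_inv_into)
      show "c {a} \<le> c {inv_into R g a}" if "a \<in> S" for a
        using R(3,4) that bij_betw_inv_into_right[OF R(3) that]
          bij_betwE[OF bij_betw_inv_into[OF R(3)]] by force
    qed (use sub RA less \<open>c T = c R\<close> in auto)
    ultimately show ?thesis by simp
  qed
qed

section \<open>Growth of the potential along contracts\<close>

text \<open>The next contract at which \<open>S\<close> stops being a best response is the first crossing of its utility
  line with that of a set of larger reward.\<close>

lemma next_breakpoint:
  assumes S: "S \<in> best \<alpha>" and T: "T \<subseteq> A" "f S < f T" "\<beta> * f S - c S \<le> \<beta> * f T - c T"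
  obtains \<gamma> U where "\<alpha> < \<gamma>" "\<gamma> \<le> \<beta>" "S \<in> demand A f c \<gamma>" "U \<in> demand A f c \<gamma>" "f S < f U"
proof -
  define L where "L = {U. U \<subseteq> A \<and> f S < f U}"
  \<comment> \<open>The utility lines of \<open>S\<close> and \<open>U\<close> cross at
    \<open>t U\<close>; for \<open>U\<close> in \<open>L\<close> the slope difference in the
    denominator is positive.\<close>
  define t where "t U = (c U - c S) / (f U - f S)" for U
  have "finite L" "L \<noteq> {}"
    using finite_actions T by (auto simp: L_def)
  then obtain U where U: "U \<in> L" and min: "\<And>V. V \<in> L \<Longrightarrow> t U \<le> t V"
    using ex_is_arg_min_if_finite[of L t] unfolding is_arg_min_linorder by blast
  have le_t: "\<gamma> \<le> t V \<longleftrightarrow> \<gamma> * f V - c V \<le> \<gamma> * f S - c S"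
    and t_le: "t V \<le> \<gamma> \<longleftrightarrow> \<gamma> * f S - c S \<le> \<gamma> * f V - c V" if "V \<in> L" for V \<gamma>
    using that by (auto simp: L_def t_def field_simps)
  note SA = best_subset[OF S] and SD = best_demand[OF S]
  have "\<alpha> < t U"
  proof (rule ccontr)
    assume "\<not> \<alpha> < t U"
    then have "\<alpha> * f S - c S \<le> \<alpha> * f U - c U"
      using t_le[OF U, where \<gamma> = \<alpha>] by simp
    then have "U \<in> demand A f c \<alpha>"
      using demand_if_demand_le[OF SD] U by (simp add: L_def)
    then have "f U \<le> f S"
      using S by (simp add: best_iff)
    then show False
      using U by (simp add: L_def)
  qed
  have "T \<in> L"
    using T by (simp add: L_def)
  then have "t U \<le> \<beta>"
    using min t_le T(3) order_trans by blast
  have "t U * f V - c V \<le> t U * f S - c S" if "V \<subseteq> A" for V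
  proof (cases "V \<in> L")
    case True
    then show ?thesis
      using min le_t by blast
  next
    case False
    \<comment> \<open>A set of no larger reward has no steeper utility line, so it cannot overtake
      \<open>S\<close> after \<open>\<alpha>\<close>.\<close>
    then have "(t U - \<alpha>) * f V \<le> (t U - \<alpha>) * f S"
      using that \<open>\<alpha> < t U\<close> by (intro mult_left_mono) (auto simp: L_def)
    then show ?thesis
      using demand_le[OF SD that] by (simp add: algebra_simps)
  qed
  then have St: "S \<in> demand A f c (t U)"
    using SA by (simp add: demand_iff)
  moreover have "t U * f S - c S \<le> t U * f U - c U"
    using t_le[OF U, where \<gamma> = "t U"] by simp
  then have "U \<in> demand A f c (t U)"
    using demand_if_demand_le[OF St] U by (simp add: L_def)
  ultimately show ?thesis
    using that \<open>\<alpha> < t U\<close> \<open>t U \<le> \<beta>\<close> U by (auto simp: L_def)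
qed

text \<open>Climb from breakpoint to breakpoint: at the next one \<open>S\<close> is tied with a set
  of larger reward, and the climb resumes from a best response there. Fewer sets exceed its reward,
  which ends the induction.\<close>

lemma potential_strict_mono:
  assumes "S \<in> best \<alpha>" "T \<in> best \<beta>" "0 \<le> \<alpha>" "f S < f T"
  shows "potential S < potential T"
  using assms
proof (induction "card {U. U \<subseteq> A \<and> f S < f U}" arbitrary: S \<alpha> rule: less_induct)
  case less
  note SA = best_subset[OF less.prems(1)] and TA = best_subset[OF less.prems(2)]
  have "\<beta> * f S - c S \<le> \<beta> * f T - c T"
    using demand_le[OF best_demand[OF less.prems(2)] SA] .
  then obtain \<gamma> V where \<gamma>: "\<alpha> < \<gamma>" "\<gamma> \<le> \<beta>" "S \<in> demand A f c \<gamma>" "V \<in> demand A f c \<gamma>" "f S < f V"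
    using next_breakpoint[OF less.prems(1) TA less.prems(4)] by blast
  obtain U where U: "U \<in> best \<gamma>"
    using best_nonempty by blast
  then have "f S < f U"
    using \<gamma> by (force simp: best_iff)
  \<comment> \<open>As \<open>S\<close> is already demanded at the smaller contract
    \<open>\<alpha>\<close>, no set demanded at \<open>\<gamma>\<close> has a smaller
    reward.\<close>
  have step: "potential S < potential W" if "W \<in> best \<gamma>" "f S < f W" for W
    using potential_less_in_demand[OF \<gamma>(3) _ that(1)] that(2) less.prems(3) \<gamma>(1)
      demand_reward_mono[OF best_demand[OF less.prems(1)]] by force
  show ?case
  proof (cases "f U < f T")
    case True
    have "{W. W \<subseteq> A \<and> f U < f W} \<subset> {W. W \<subseteq> A \<and> f S < f W}"
      using \<open>f S < f U\<close> best_subset[OF U] by (auto intro: less_trans)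
    then have "card {W. W \<subseteq> A \<and> f U < f W} < card {W. W \<subseteq> A \<and> f S < f W}"
      using finite_actions by (intro psubset_card_mono) auto
    then have "potential U < potential T"
      using less.hyps U less.prems \<gamma>(1) True by simp
    then show ?thesis
      using step[OF U \<open>f S < f U\<close>] by simp
  next
    case False
    then have "f U = f T"
      using best_reward_mono[OF U less.prems(2) \<gamma>(2)] by simp
    \<comment> \<open>By the equality of rewards \<open>T\<close> is itself a best response at
      \<open>\<gamma>\<close>, so a single step reaches it.\<close>
    then have "T \<in> best \<gamma>"
      using best_eq_if_reward_eq U less.prems(2) by blast
    then show ?thesis
      using step less.prems(4) by blast
  qed
qed

lemma critical_values_bound:
  "finite (critical_values A f c) \<and>
    card (critical_values A f c) \<le> card A * (card A + 1) div 2"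
proof -
  let ?C = "critical_values A f c" and ?N = "card A * (card A + 1) div 2"
  \<comment> \<open>Any choice of best responses works, since \<open>potential_strict_mono\<close>
    compares arbitrary ones.\<close>
  define \<Phi> where "\<Phi> \<alpha> = potential (SOME S. S \<in> best \<alpha>)" for \<alpha>
  have some: "(SOME S. S \<in> best \<alpha>) \<in> best \<alpha>" for \<alpha>
    using best_nonempty by (simp add: some_in_eq)
  have less: "\<Phi> \<alpha> < \<Phi> \<beta>" if "0 \<le> \<alpha>" "\<alpha> < \<beta>" "\<beta> \<in> ?C" for \<alpha> \<beta>
    unfolding \<Phi>_def using potential_strict_mono critical_reward_less some that by blast
  have pos: "0 < \<beta>" if "\<beta> \<in> ?C" for \<beta>
    using that by (simp add: critical_values_def)
  have inj: "inj_on \<Phi> ?C"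
    using less pos by (intro linorder_inj_onI') (metis less_imp_le less_irrefl)
  \<comment> \<open>The lower end 1 comes from comparison with contract 0, which lies below every
    critical value; it leaves \<open>?N\<close> possible values instead of
    \<open>?N + 1\<close>.\<close>
  have "\<Phi> ` ?C \<subseteq> {1..?N}"
  proof
    fix k assume "k \<in> \<Phi> ` ?C"
    then obtain \<beta> where \<beta>: "\<beta> \<in> ?C" "k = \<Phi> \<beta>"
      by blast
    have "\<Phi> \<beta> \<le> ?N"
      unfolding \<Phi>_def potential_def
      using finite_actions best_subset[OF some] by (rule sum_cost_rank_le)
    then show "k \<in> {1..?N}"
      using less[of 0 \<beta>] pos \<beta> by simp
  qed
  then show ?thesis
    using inj inj_on_finite[OF inj, of "{1..?N}"] card_inj_on_le[OF inj, of "{1..?N}"] by simp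
qed

end

theorem theorem3p3:
  fixes A :: "'a set" and f c :: "'a set \<Rightarrow> real" and n :: nat
  assumes "finite A" and "card A = n"
    and "\<And>S. S \<subseteq> A \<Longrightarrow> f S \<ge> 0" and "f {} = 0" and "mono_on (Pow A) f"
    and "ultra A f"
    and "\<And>S. S \<subseteq> A \<Longrightarrow> c S \<ge> 0" and "additive_on A c"
  shows "finite (critical_values A f c) \<and> card (critical_values A f c) \<le> n * (n + 1) div 2"
proof -
  interpret ultra_contract A f c
    using assms by unfold_locales
  show ?thesis
    using critical_values_bound assms(2) by simp
qed

end
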